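(* Let $A,B,C$ be random variables with values in metric spaces $\mathcal{A},\mathcal{B},\mathcal{C}$. Assume that their joint distribution is absolutely continuous with respect to a product measure, with density $p(\cdot)$, and that the density $(a,b,c)\mapsto p(a,b,c)$ is continuous. Then the following are equivalent: (1) The intersection property $$X \perp\!\!\!\perp A \mid (B,C)\ \text{ and }\ X \perp\!\!\!\perp B\mid (A,C)\quad\Longrightarrow\quad X\perp\!\!\!\perp (A,B)\mid C$$ holds for all random variables $X$. (2) For every $c$ with $p(c)>0$, all path-connected components $Z^c_i$ of $\mathrm{supp}_c(A,B)$ are equivalent (see context), i.e. there is only one set $U^c_1$. In particular, this is the case if for each $c$ with $p(c)>0$ the set $\mathrm{supp}_c(A,B)$ has only one path-connected component, or if the density $p$ is strictly positive.
   Context: The random variables may be multi-dimensional. It is assumed throughout that joint distributions (including that of $X,A,B,C$) are absolutely continuous with respect to a product measure; $p$ denotes the joint density (e.g. a probability mass function or probability density function), and also its marginal and conditional densities, distinguished by their arguments. Conditional independence: $X \perp\!\!\!\perp A \mid B$ means $p(x,a\mid b)=p(x\mid b)\,p(a\mid b)$ for all $x,a,b$ with $p(b)>0$. A path in a metric space $\mathcal{S}$ is a continuous map $\lambda:[0,1]\to\mathcal{S}$; a set is path-connected if any two of its points are joined by a path inside it. For $c$ with $p(c)>0$ define the (not necessarily closed) support $\mathrm{supp}_c(A,B):=\{(a,b): p(a,b,c)>0\}$. For $M\subset\mathcal{A}\times\mathcal{B}$ let $\mathrm{proj}_A(M):=\{a\in\mathcal{A}:\exists b \text{ with }(a,b)\in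 M\}$ and $\mathrm{proj}_B(M):=\{b\in\mathcal{B}:\exists a\text{ with }(a,b)\in M\}$. Let $(Z^c_i)_i$ be the path-connected components of $\mathrm{supp}_c(A,B)$. Two components $Z^c_{i_1},Z^c_{i_2}$ are coordinate-wise connected if $\mathrm{proj}_A(Z^c_{i_1})\cap\mathrm{proj}_A(Z^c_{i_2})\neq\emptyset$ or $\mathrm{proj}_B(Z^c_{i_1})\cap\mathrm{proj}_B(Z^c_{i_2})\neq\emptyset$. Two components $Z^c_i,Z^c_j$ are equivalent if there is a finite sequence $Z^c_i=Z^c_{i_1},\dots,Z^c_{i_m}=Z^c_j$ in which any two neighbours are coordinate-wise connected. Each equivalence class is represented by the union of its members; these unions are denoted $(U^c_i)_i$. The case without a variable $C$ is treated as $C$ being deterministic, $p(c)=1$ for some $c$.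
   Formalization: Added: the reference measures on A and B are positive on nonempty open sets; the marginals p(a,c), p(b,c), p(c) are finite everywhere; the density of (X,A,B,C) vanishes wherever p(a,b,c)=0. Without these the claim fails or conditional densities are undefined. *)

theory Defs
  imports "HOL-Probability.Probability"
begin

section \<open>Densities\<close>

definition has_density ::
  "'w measure \<Rightarrow> 'v measure \<Rightarrow> ('w \<Rightarrow> 'v) \<Rightarrow> ('v \<Rightarrow> real) \<Rightarrow> bool" where
  "has_density M N V f \<longleftrightarrow>
     (\<forall>v\<in>space N. 0 \<le> f v) \<and> distributed M N V (\<lambda>v. ennreal (f v))"

text \<open>A continuous density is determined by the distribution only on the support of the
  reference measure; full support excludes regions where its values carry no meaning.\<close>
definition full_support :: "'a::topological_space measure \<Rightarrow> bool" where
  "full_support \<mu> \<longleftrightarrow> (\<forall>U. open U \<longrightarrow> U \<noteq> {} \<longrightarrow> 0 < emeasure \<mu> U)"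

definition marginal_AC :: "'b measure \<Rightarrow> ('a \<times> 'b \<times> 'c \<Rightarrow> real) \<Rightarrow> 'a \<Rightarrow> 'c \<Rightarrow> ennreal" where
  "marginal_AC MB p a c = (\<integral>\<^sup>+b. ennreal (p (a, b, c)) \<partial>MB)"

definition marginal_BC :: "'a measure \<Rightarrow> ('a \<times> 'b \<times> 'c \<Rightarrow> real) \<Rightarrow> 'b \<Rightarrow> 'c \<Rightarrow> ennreal" where
  "marginal_BC MA p b c = (\<integral>\<^sup>+a. ennreal (p (a, b, c)) \<partial>MA)"

definition marginal_C ::
  "'a measure \<Rightarrow> 'b measure \<Rightarrow> ('a \<times> 'b \<times> 'c \<Rightarrow> real) \<Rightarrow> 'c \<Rightarrow> ennreal" where
  "marginal_C MA MB p c = (\<integral>\<^sup>+(a, b). ennreal (p (a, b, c)) \<partial>(MA \<Otimes>\<^sub>M MB))"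

text \<open>The marginal densities are real-valued, not merely almost everywhere finite.
  Conditional densities given \<open>(A,C)\<close>, \<open>(B,C)\<close> and \<open>C\<close> are formed pointwise, so this is
  what makes the quotients meaningful wherever the marginal is positive.\<close>
definition finite_marginals ::
  "'a measure \<Rightarrow> 'b measure \<Rightarrow> ('a \<times> 'b \<times> 'c \<Rightarrow> real) \<Rightarrow> bool" where
  "finite_marginals MA MB p \<longleftrightarrow>
     (\<forall>a c. marginal_AC MB p a c < \<infinity>) \<and>
     (\<forall>b c. marginal_BC MA p b c < \<infinity>) \<and>
     (\<forall>c. marginal_C MA MB p c < \<infinity>)"

section \<open>Conditional independence\<close>

text \<open>\<open>cond_indep MX MY MZ f\<close> is \<open>X \<bottom> Y | Z\<close> for the density \<open>f\<close> of \<open>(X,Y,Z)\<close>: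
  \<open>p(x,y|z) = p(x|z) p(y|z)\<close> for all \<open>x, y, z\<close> with \<open>p(z) > 0\<close>. It is a pointwise property
  of the density \<open>f\<close>, also in conditioning values \<open>z\<close> that form a null set.\<close>
definition cond_indep ::
  "'x measure \<Rightarrow> 'y measure \<Rightarrow> 'z measure \<Rightarrow> ('x \<times> 'y \<times> 'z \<Rightarrow> real) \<Rightarrow> bool" where
  "cond_indep MX MY MZ f \<longleftrightarrow>
     (\<forall>x\<in>space MX. \<forall>y\<in>space MY. \<forall>z\<in>space MZ.
        let pXYZ = ennreal (f (x, y, z));
            pXZ = (\<integral>\<^sup>+y'. ennreal (f (x, y', z)) \<partial>MY);
            pYZ = (\<integral>\<^sup>+x'. ennreal (f (x', y, z)) \<partial>MX);
            pZ = (\<integral>\<^sup>+x'. \<integral>\<^sup>+y'. ennreal (f (x', y', z)) \<partial>MY \<partial>MX)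
        in pZ > 0 \<longrightarrow> pXYZ / pZ = (pXZ / pZ) * (pYZ / pZ))"

text \<open>\<open>f\<close> is a joint density of \<open>(X,A,B,C)\<close> that has the given \<open>p\<close> as its density of
  \<open>(A,B,C)\<close> at every point. Where \<open>p(a,b,c) = 0\<close>, the first condition already forces
  \<open>f(x,a,b,c) = 0\<close> for almost all \<open>x\<close>; the second one fixes the version for all \<open>x\<close>. Together
  they say \<open>f(x,a,b,c) = p(x|a,b,c) p(a,b,c)\<close> for a conditional density \<open>p(x|a,b,c)\<close>.\<close>
definition extends_density :: "'x measure \<Rightarrow> ('x \<times> 'v \<Rightarrow> real) \<Rightarrow> ('v \<Rightarrow> real) \<Rightarrow> bool" where
  "extends_density MX f p \<longleftrightarrow>
     (\<forall>v. (\<integral>\<^sup>+x. ennreal (f (x, v)) \<partial>MX) = ennreal (p v)) \<and>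
     (\<forall>x\<in>space MX. \<forall>v. p v = 0 \<longrightarrow> f (x, v) = 0)"

text \<open>\<open>X\<close> ranges over random variables with values in an arbitrary measurable space on the
  type \<open>'x\<close>, with joint density with respect to a product measure; the dominating measure
  \<open>MX\<close> is arbitrary as well, so this includes discrete and continuous \<open>X\<close>.\<close>
definition intersection_property ::
  "'x itself \<Rightarrow> 'w measure \<Rightarrow> 'a measure \<Rightarrow> 'b measure \<Rightarrow> 'c measure \<Rightarrow>
   ('w \<Rightarrow> 'a) \<Rightarrow> ('w \<Rightarrow> 'b) \<Rightarrow> ('w \<Rightarrow> 'c) \<Rightarrow> ('a \<times> 'b \<times> 'c \<Rightarrow> real) \<Rightarrow> bool" where
  "intersection_property (_ :: 'x itself) M MA MB MC A B C p \<longleftrightarrow>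
     (\<forall>(MX :: 'x measure) X f.
        sigma_finite_measure MX \<longrightarrow>
        has_density M (MX \<Otimes>\<^sub>M (MA \<Otimes>\<^sub>M (MB \<Otimes>\<^sub>M MC))) (\<lambda>\<omega>. (X \<omega>, A \<omega>, B \<omega>, C \<omega>)) f \<longrightarrow>
        extends_density MX f p \<longrightarrow>
        cond_indep MX MA (MB \<Otimes>\<^sub>M MC) (\<lambda>(x, a, (b, c)). f (x, a, b, c)) \<longrightarrow>
        cond_indep MX MB (MA \<Otimes>\<^sub>M MC) (\<lambda>(x, b, (a, c)). f (x, a, b, c)) \<longrightarrow>
        cond_indep MX (MA \<Otimes>\<^sub>M MB) MC (\<lambda>(x, (a, b), c). f (x, a, b, c)))"

section \<open>Components of the support\<close>

definition supp_at :: "('a \<times> 'b \<times> 'c \<Rightarrow> real) \<Rightarrow> 'c \<Rightarrow> ('a \<times> 'b) set" where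
  "supp_at p c = {(a, b). p (a, b, c) > 0}"

definition path_comps :: "'a::topological_space set \<Rightarrow> 'a set set" where
  "path_comps S = path_component_set S ` S"

definition coordwise_connected :: "('a \<times> 'b) set \<Rightarrow> ('a \<times> 'b) set \<Rightarrow> bool" where
  "coordwise_connected Z Z' \<longleftrightarrow> fst ` Z \<inter> fst ` Z' \<noteq> {} \<or> snd ` Z \<inter> snd ` Z' \<noteq> {}"

definition equivalent_comps ::
  "('a::topological_space \<times> 'b::topological_space) set \<Rightarrow> (('a \<times> 'b) set \<times> ('a \<times> 'b) set) set"
where
  "equivalent_comps S =
     {(Z, Z'). Z \<in> path_comps S \<and> Z' \<in> path_comps S \<and> coordwise_connected Z Z'}\<^sup>*"

definition all_comps_equivalent ::
  "('a::topological_space \<times> 'b::topological_space) set \<Rightarrow> bool" where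
  "all_comps_equivalent S \<longleftrightarrow>
     (\<forall>Z \<in> path_comps S. \<forall>Z' \<in> path_comps S. (Z, Z') \<in> equivalent_comps S)"

definition component_unions ::
  "('a::topological_space \<times> 'b::topological_space) set \<Rightarrow> ('a \<times> 'b) set set" where
  "component_unions S =
     (\<lambda>Z. \<Union>{Z' \<in> path_comps S. (Z, Z') \<in> equivalent_comps S}) ` path_comps S"

end

(*
  For fixed c the support S is open in the product, so any two points of a box inside S are linked
  through shared coordinates. Hence the classes of S under "linked by a chain of points of S, neighbours
  sharing a coordinate" are open, no path can leave a class, and all path components are equivalent iff
  S is a single class. Writing f for the density of (X,A,B,C), the two conditional independences say
  that the quotient f(x,a,b,c) / p(a,b,c) is unchanged when only a or only b is moved within S, so it is
  constant on classes, and X is independent of (A,B) given C iff it is constant on all of S.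
  With at least two classes at c0, the indicator of one of them is a counterexample X.
*)
theory Submission
  imports Defs
begin

section \<open>Classes of points linked through shared coordinates\<close>

text \<open>Chains run through points of \<open>S\<close> instead of path components; paths
  disappear from the relation, and topology enters only through openness of the classes.\<close>

definition coord_step :: "('a \<times> 'b) set \<Rightarrow> (('a \<times> 'b) \<times> ('a \<times> 'b)) set" where
  "coord_step S = {(s, t). s \<in> S \<and> t \<in> S \<and> (fst s = fst t \<or> snd s = snd t)}"

text \<open>An equivalence class when \<open>s\<close> is in \<open>S\<close>; for \<open>s\<close>
  outside \<open>S\<close>, reflexivity of the closure leaves just \<open>{s}\<close>.\<close>

definition coord_class :: "('a \<times> 'b) set \<Rightarrow> 'a \<times> 'b \<Rightarrow> ('a \<times> 'b) set" where
  "coord_class S s = (coord_step S)\<^sup>* `` {s}"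

lemma coord_stepI:
  "\<lbrakk>s \<in> S; t \<in> S; fst s = fst t \<or> snd s = snd t\<rbrakk> \<Longrightarrow> (s, t) \<in> (coord_step S)\<^sup>*"
  unfolding coord_step_def by blast

lemma sym_rtrancl_coord_step: "sym ((coord_step S)\<^sup>*)"
  by (rule sym_rtrancl) (auto simp: sym_def coord_step_def)

lemma coord_class_self: "s \<in> coord_class S s"
  by (simp add: coord_class_def)

lemma coord_class_subset:
  assumes "s \<in> S"
  shows "coord_class S s \<subseteq> S"
proof
  fix t assume "t \<in> coord_class S s"
  then have "(s, t) \<in> (coord_step S)\<^sup>*" by (simp add: coord_class_def)
  then show "t \<in> S"
    using assms by cases (auto simp: coord_step_def)
qed

lemma coord_class_closed:
  assumes "t \<in> coord_class S s" "t \<in> S" "u \<in> S" "fst t = fst u \<or> snd t = snd u"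
  shows "u \<in> coord_class S s"
  using assms coord_stepI[of t S u] by (auto simp: coord_class_def intro: rtrancl_trans)

lemma open_prod_box:
  fixes S :: "('a::topological_space \<times> 'b::topological_space) set"
  assumes "open S" "(a, b) \<in> S"
  obtains U V where "open U" "open V" "a \<in> U" "b \<in> V" "U \<times> V \<subseteq> S"
  using open_prod_elim[OF assms] by (metis SigmaE2)

text \<open>A box around a point \<open>(a, b)\<close> of the class lies in \<open>S\<close>, and
  any \<open>(a', b')\<close> in the box is reached in two steps through the corner
  \<open>(a', b)\<close>.\<close>

lemma open_coord_class:
  fixes S :: "('a::topological_space \<times> 'b::topological_space) set"
  assumes "open S" "s \<in> S"
  shows "open (coord_class S s)"
proof (subst open_prod_def, intro ballI)
  fix t assume t: "t \<in> coord_class S s"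
  then have tS: "t \<in> S" using coord_class_subset[OF assms(2)] by auto
  obtain a b where ab: "t = (a, b)" by (cases t)
  obtain U V where UV: "open U" "open V" "a \<in> U" "b \<in> V" "U \<times> V \<subseteq> S"
    using open_prod_box[OF assms(1)] tS ab by metis
  have "(a', b') \<in> coord_class S s" if "a' \<in> U" "b' \<in> V" for a' b'
  proof -
    have "(a', b) \<in> coord_class S s"
      using coord_class_closed[OF t tS, of "(a', b)"] that UV ab by auto
    then show ?thesis
      using coord_class_closed[of "(a', b)" S s "(a', b')"] that UV by auto
  qed
  then show "\<exists>U V. open U \<and> open V \<and> t \<in> U \<times> V \<and> U \<times> V \<subseteq> coord_class S s"
    using UV ab by blast
qed

text \<open>The class of \<open>s\<close> and the union of all other classes are open, disjoint and
  cover \<open>S\<close>, so a connected set meeting both would be separated.\<close>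

lemma connected_subset_coord_class:
  fixes S :: "('a::topological_space \<times> 'b::topological_space) set"
  assumes "open S" "connected P" "P \<subseteq> S" "s \<in> P"
  shows "P \<subseteq> coord_class S s"
proof (rule ccontr)
  assume "\<not> ?thesis"
  then obtain t where t: "t \<in> P" "t \<notin> coord_class S s" by blast
  let ?K = "coord_class S s" and ?L = "\<Union>u\<in>S - coord_class S s. coord_class S u"
  have "open ?K" "open ?L"
    using assms open_coord_class[OF assms(1)] by blast+
  moreover have "?K \<inter> ?L = {}"
    using sym_rtrancl_coord_step[of S]
    by (auto simp: coord_class_def sym_def intro: rtrancl_trans)
  moreover have "P \<subseteq> ?K \<union> ?L" "?K \<inter> P \<noteq> {}" "?L \<inter> P \<noteq> {}"
    using assms(3,4) t coord_class_self[of _ S] by blast+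
  ultimately show False
    using assms(2) unfolding connected_def by blast
qed

section \<open>Chains of components versus chains of points\<close>

lemma equivalent_comps_coord_class:
  fixes S :: "('a::topological_space \<times> 'b::topological_space) set"
  assumes "open S" "(Z, Z') \<in> equivalent_comps S" "Z \<in> path_comps S" "s \<in> Z" "t \<in> Z'"
  shows "t \<in> coord_class S s"
proof -
  \<comment> \<open>Path components are connected, so each lies within one class.\<close>
  have comp: "(s, t) \<in> (coord_step S)\<^sup>*" if Z: "Z \<in> path_comps S" and "s \<in> Z" "t \<in> Z" for Z s t
  proof -
    obtain r where "Z = path_component_set S r" using Z by (auto simp: path_comps_def)
    then have "connected Z" "Z \<subseteq> S"
      by (auto simp: path_connected_imp_connected path_component_subset)
    then show ?thesis
      using connected_subset_coord_class[OF assms(1) _ _ \<open>s \<in> Z\<close>] \<open>t \<in> Z\<close>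
      by (auto simp: coord_class_def)
  qed
  have sub: "Z \<subseteq> S" if "Z \<in> path_comps S" for Z
    using that path_component_subset by (auto simp: path_comps_def)
  have "(s, t) \<in> (coord_step S)\<^sup>*"
    using assms(2)[unfolded equivalent_comps_def] assms(5)
  \<comment> \<open>The end point stays general: the next shared coordinate dictates the point
    \<open>u\<close> at which the previous component is left.\<close>
  proof (induction arbitrary: t)
    case base
    then show ?case using comp assms by blast
  next
    case (step Y Y')
    then obtain u v where uv: "u \<in> Y" "v \<in> Y'" "fst u = fst v \<or> snd u = snd v"
      unfolding coordwise_connected_def by auto
    moreover have "Y \<in> path_comps S" "Y' \<in> path_comps S" using step by auto
    ultimately have "(u, v) \<in> (coord_step S)\<^sup>*" "(v, t) \<in> (coord_step S)\<^sup>*"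
      using coord_stepI[of u S v] sub[of Y] sub[of Y'] comp[of Y' v t] step.prems by auto
    then show ?case using step.IH[OF uv(1)] by (meson rtrancl_trans)
  qed
  then show ?thesis by (simp add: coord_class_def)
qed

text \<open>Two points sharing a coordinate make the projections of their path components meet, so
  each step between points gives a step between components, possibly the same one.\<close>

lemma coord_class_equivalent_comps:
  assumes "t \<in> coord_class S s" "s \<in> S"
  shows "(path_component_set S s, path_component_set S t) \<in> equivalent_comps S"
proof -
  have "(s, t) \<in> (coord_step S)\<^sup>*" using assms by (simp add: coord_class_def)
  then show ?thesis
  proof induction
    case base
    then show ?case by (simp add: equivalent_comps_def)
  next
    case (step u v)
    then have uv: "u \<in> S" "v \<in> S" "fst u = fst v \<or> snd u = snd v"
      by (auto simp: coord_step_def)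
    then have "u \<in> path_component_set S u" "v \<in> path_component_set S v"
      by (simp_all add: path_component_refl)
    then have "coordwise_connected (path_component_set S u) (path_component_set S v)"
      using uv(3) unfolding coordwise_connected_def by (metis IntI emptyE imageI)
    then show ?case
      using step.IH uv unfolding equivalent_comps_def path_comps_def
      by (auto intro: rtrancl_into_rtrancl)
  qed
qed

lemma all_comps_equivalent_iff_coord_class:
  fixes S :: "('a::topological_space \<times> 'b::topological_space) set"
  assumes "open S"
  shows "all_comps_equivalent S \<longleftrightarrow> (\<forall>s\<in>S. S \<subseteq> coord_class S s)"
proof
  assume *: "all_comps_equivalent S"
  show "\<forall>s\<in>S. S \<subseteq> coord_class S s"
  proof (intro ballI subsetI)
    fix s t assume "s \<in> S" "t \<in> S"
    then show "t \<in> coord_class S s"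
      using * equivalent_comps_coord_class[OF assms, of "path_component_set S s" "path_component_set S t" s t]
      by (auto simp: all_comps_equivalent_def path_comps_def path_component_refl)
  qed
next
  assume "\<forall>s\<in>S. S \<subseteq> coord_class S s"
  then have "(path_component_set S s, path_component_set S t) \<in> equivalent_comps S"
    if "s \<in> S" "t \<in> S" for s t
    using that coord_class_equivalent_comps[of t S s] by blast
  then show "all_comps_equivalent S"
    unfolding all_comps_equivalent_def path_comps_def by auto
qed

section \<open>Uniqueness of the union of components\<close>

lemma path_comps_disjoint:
  "\<lbrakk>Z \<in> path_comps S; Z' \<in> path_comps S; z \<in> Z; z \<in> Z'\<rbrakk> \<Longrightarrow> Z = Z'"
  unfolding path_comps_def by (elim imageE) (metis path_component_eq)

lemma path_comps_nonempty: "Z \<in> path_comps S \<Longrightarrow> Z \<noteq> {}"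
  unfolding path_comps_def using path_component_refl by fastforce

text \<open>Unions remember their members: as distinct components are disjoint, a point of
  \<open>Z'\<close> in the union for \<open>Z\<close> forces \<open>Z'\<close> to be equivalent to
  \<open>Z\<close>. Nonemptiness of \<open>S\<close> supplies the existence half, since an empty
  \<open>S\<close> has no component and no union.\<close>

lemma ex1_component_union_iff:
  assumes "S \<noteq> {}"
  shows "(\<exists>!U. U \<in> component_unions S) \<longleftrightarrow> all_comps_equivalent S"
proof
  assume ex1: "\<exists>!U. U \<in> component_unions S"
  show "all_comps_equivalent S"
    unfolding all_comps_equivalent_def
  proof (intro ballI)
    fix Z Z' assume Z: "Z \<in> path_comps S" and Z': "Z' \<in> path_comps S"
    then have "\<Union>{Y \<in> path_comps S. (Z, Y) \<in> equivalent_comps S}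
        = \<Union>{Y \<in> path_comps S. (Z', Y) \<in> equivalent_comps S}"
      using ex1 unfolding component_unions_def by (metis (no_types, lifting) imageI)
    moreover have "(Z', Z') \<in> equivalent_comps S"
      by (simp add: equivalent_comps_def)
    ultimately have "Z' \<subseteq> \<Union>{Y \<in> path_comps S. (Z, Y) \<in> equivalent_comps S}"
      using Z' by blast
    moreover obtain z where "z \<in> Z'" using path_comps_nonempty[OF Z'] by blast
    ultimately obtain Y where "Y \<in> path_comps S" "(Z, Y) \<in> equivalent_comps S" "z \<in> Y" by blast
    then show "(Z, Z') \<in> equivalent_comps S"
      using path_comps_disjoint[OF Z'] \<open>z \<in> Z'\<close> by metis
  qed
next
  assume all: "all_comps_equivalent S"
  then have "\<Union>{Y \<in> path_comps S. (Z, Y) \<in> equivalent_comps S} = \<Union>(path_comps S)"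
    if "Z \<in> path_comps S" for Z
    using that unfolding all_comps_equivalent_def by blast
  then have "component_unions S = (\<lambda>_. \<Union>(path_comps S)) ` path_comps S"
    unfolding component_unions_def by (intro image_cong) auto
  moreover have "path_comps S \<noteq> {}" using assms by (simp add: path_comps_def)
  ultimately show "\<exists>!U. U \<in> component_unions S" by auto
qed

section \<open>Conditional independence without quotients\<close>

text \<open>Multiplication by \<open>P * P\<close> clears all quotients and can be undone, because a
  factor that is neither zero nor infinite cancels in \<open>ennreal\<close>.\<close>

lemma ennreal_divide_eq_mult_divide_iff:
  fixes f g q P :: ennreal
  assumes "0 < P" "P < \<infinity>"
  shows "f / P = (g / P) * (q / P) \<longleftrightarrow> f * P = g * q"
proof -
  have cancel: "x / P * P = x" for x
    using assms mult_divide_eq_ennreal[of P x] by (simp add: ennreal_times_divide mult.commute)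
  have "(f / P) * (P * P) = (f / P * P) * P" "(g / P) * (q / P) * (P * P) = (g / P * P) * (q / P * P)"
    by (simp_all only: ac_simps)
  then have "(f / P) * (P * P) = f * P" "(g / P) * (q / P) * (P * P) = g * q"
    by (simp_all only: cancel)
  moreover have "x * (P * P) = y * (P * P) \<longleftrightarrow> x = y" for x y :: ennreal
    using assms by (metis ennreal_mult_divide_eq infinity_ennreal_def less_irrefl mult.assoc)
  ultimately show ?thesis by metis
qed

text \<open>Integrating the proportionality over \<open>y'\<close> gives back the factorization with its marginals.\<close>
lemma cond_indep_iff_proportional:
  fixes f :: "'x \<times> 'y \<times> 'z \<Rightarrow> real"
  assumes "sigma_finite_measure MX" "sigma_finite_measure MY"
    and meas: "\<And>z. z \<in> space MZ \<Longrightarrow> (\<lambda>(x, y). ennreal (f (x, y, z))) \<in> borel_measurable (MX \<Otimes>\<^sub>M MY)"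
    and marg: "\<And>y z. (\<integral>\<^sup>+x. ennreal (f (x, y, z)) \<partial>MX) = q y z"
    and zero: "\<And>x y z. x \<in> space MX \<Longrightarrow> q y z = 0 \<Longrightarrow> f (x, y, z) = 0"
    and pos: "\<And>y z. 0 < q y z \<Longrightarrow> 0 < (\<integral>\<^sup>+y. q y z \<partial>MY)"
    and fin: "\<And>z. (\<integral>\<^sup>+y. q y z \<partial>MY) < \<infinity>"
  shows "cond_indep MX MY MZ f \<longleftrightarrow>
    (\<forall>x\<in>space MX. \<forall>y\<in>space MY. \<forall>y'\<in>space MY. \<forall>z\<in>space MZ.
       ennreal (f (x, y, z)) * q y' z = ennreal (f (x, y', z)) * q y z)"
proof -
  interpret pair_sigma_finite MX MY
    by (simp add: assms pair_sigma_finite_def)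
  define Q where "Q z = (\<integral>\<^sup>+y. q y z \<partial>MY)" for z
  define g where "g x z = (\<integral>\<^sup>+y. ennreal (f (x, y, z)) \<partial>MY)" for x z
  \<comment> \<open>\<open>cond_indep\<close> computes \<open>p(z)\<close> by integrating over
    \<open>y\<close> first; Tonelli turns this into \<open>Q z\<close>, the integral of the marginal
    \<open>q\<close>.\<close>
  have tonelli: "(\<integral>\<^sup>+x. g x z \<partial>MX) = Q z"
    if "z \<in> space MZ" for z
    using Fubini'[OF meas[OF that]] by (simp add: marg Q_def g_def)
  have meas_q: "(\<lambda>y. q y z) \<in> borel_measurable MY" if "z \<in> space MZ" for z
    using measurable_compose[OF measurable_pair_swap' meas[OF that]]
      M1.borel_measurable_nn_integral[of "\<lambda>y x. ennreal (f (x, y, z))" MY]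
    by (simp add: marg case_prod_unfold)
  have meas_f: "(\<lambda>y. ennreal (f (x, y, z))) \<in> borel_measurable MY"
    if "x \<in> space MX" "z \<in> space MZ" for x z
    using measurable_compose[OF measurable_Pair1'[OF that(1)] meas[OF that(2)]] by simp
  have pQ: "0 < Q z" if "0 < q y z" for y z using pos that by (simp add: Q_def)
  have fQ: "Q z < \<infinity>" for z using fin by (simp add: Q_def)
  have "cond_indep MX MY MZ f \<longleftrightarrow>
      (\<forall>x\<in>space MX. \<forall>y\<in>space MY. \<forall>z\<in>space MZ. 0 < Q z \<longrightarrow>
         ennreal (f (x, y, z)) * Q z = g x z * q y z)"
    unfolding cond_indep_def Let_def
    by (simp add: tonelli marg g_def[symmetric] ennreal_divide_eq_mult_divide_iff[OF _ fQ] cong: ball_cong)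
  also have "\<dots> \<longleftrightarrow> (\<forall>x\<in>space MX. \<forall>y\<in>space MY. \<forall>y'\<in>space MY. \<forall>z\<in>space MZ.
       ennreal (f (x, y, z)) * q y' z = ennreal (f (x, y', z)) * q y z)"
  proof (intro iffI ballI impI)
    fix x y y' z
    assume eq: "\<forall>x\<in>space MX. \<forall>y\<in>space MY. \<forall>z\<in>space MZ. 0 < Q z \<longrightarrow>
         ennreal (f (x, y, z)) * Q z = g x z * q y z"
      and in_space: "x \<in> space MX" "y \<in> space MY" "y' \<in> space MY" "z \<in> space MZ"
    show "ennreal (f (x, y, z)) * q y' z = ennreal (f (x, y', z)) * q y z"
    \<comment> \<open>Where \<open>q\<close> vanishes, so does \<open>f\<close>, and both sides are
      0. This covers \<open>Q z = 0\<close>, where the factorization says nothing.\<close>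
    proof (cases "q y z = 0 \<or> q y' z = 0")
      case True
      then show ?thesis using zero in_space(1) by fastforce
    next
      case False
      then have Q: "0 < Q z" using pQ zero_less_iff_neq_zero by blast
      \<comment> \<open>Multiplied by \<open>Q z\<close>, either side equals
        \<open>g x z * q y z * q y' z\<close>, which is symmetric in \<open>y\<close> and
        \<open>y'\<close>.\<close>
      have "(ennreal (f (x, y, z)) * q y' z) * Q z = (ennreal (f (x, y, z)) * Q z) * q y' z"
        by (simp add: ac_simps)
      also have "\<dots> = (ennreal (f (x, y', z)) * Q z) * q y z"
        using eq in_space Q by (simp add: ac_simps)
      also have "\<dots> = (ennreal (f (x, y', z)) * q y z) * Q z"
        by (simp add: ac_simps)
      finally show ?thesis
        using Q fQ[of z] by (metis ennreal_mult_divide_eq infinity_ennreal_def less_irrefl)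
    qed
  next
    fix x y z
    assume eq: "\<forall>x\<in>space MX. \<forall>y\<in>space MY. \<forall>y'\<in>space MY. \<forall>z\<in>space MZ.
       ennreal (f (x, y, z)) * q y' z = ennreal (f (x, y', z)) * q y z"
      and in_space: "x \<in> space MX" "y \<in> space MY" "z \<in> space MZ"
    have "ennreal (f (x, y, z)) * Q z = (\<integral>\<^sup>+y'. ennreal (f (x, y, z)) * q y' z \<partial>MY)"
      unfolding Q_def using meas_q in_space by (simp add: nn_integral_cmult)
    also have "\<dots> = (\<integral>\<^sup>+y'. ennreal (f (x, y', z)) * q y z \<partial>MY)"
      using eq in_space by (intro nn_integral_cong) auto
    also have "\<dots> = g x z * q y z"
      unfolding g_def using meas_f in_space by (simp add: nn_integral_multc)
    finally show "ennreal (f (x, y, z)) * Q z = g x z * q y z" .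
  qed
  finally show ?thesis .
qed

section \<open>Positive integrals and densities on graphs\<close>

lemma nn_integral_pos_if_pos_on_open:
  assumes "full_support \<mu>" "g \<in> borel_measurable \<mu>" "open U" "U \<subseteq> space \<mu>" "U \<noteq> {}"
    and "\<And>u. u \<in> U \<Longrightarrow> 0 < g u"
  shows "0 < (\<integral>\<^sup>+u. g u \<partial>\<mu>)"
proof -
  have "0 < emeasure \<mu> U" using assms by (simp add: full_support_def)
  also have "\<dots> \<le> emeasure \<mu> {u \<in> space \<mu>. g u \<noteq> 0}"
    using assms by (intro emeasure_mono) (auto dest: assms(6))
  finally have "(\<integral>\<^sup>+u. g u \<partial>\<mu>) \<noteq> 0"
    using assms(2) by (subst nn_integral_0_iff) auto
  then show ?thesis by (simp add: zero_less_iff_neq_zero)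
qed

text \<open>Supplies a joint density for an \<open>X\<close> that is a function of the other
  variables. For fixed \<open>v\<close> only \<open>x = h v\<close> contributes to the sum over
  \<open>F\<close>, so integrating out \<open>x\<close> returns \<open>q v\<close>.\<close>

lemma distributed_graph:
  assumes dist: "distributed M N V q" and N: "sigma_finite_measure N"
    and F: "finite F" and h: "h \<in> measurable N (count_space F)"
  shows "distributed M (count_space F \<Otimes>\<^sub>M N) (\<lambda>\<omega>. (h (V \<omega>), V \<omega>)) (\<lambda>(x, v). if x = h v then q v else 0)"
proof -
  let ?X = "count_space F" and ?f = "\<lambda>(x, v). if x = h v then q v else 0"
  have V[measurable]: "V \<in> measurable M N" and q[measurable]: "q \<in> borel_measurable N"
    using dist by (auto simp: distributed_def)
  note h[measurable]
  interpret X: sigma_finite_measure ?X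
    by (rule sigma_finite_measure_count_space_finite[OF F])
  interpret pair_sigma_finite ?X N
    by (simp add: N X.sigma_finite_measure_axioms pair_sigma_finite_def)
  have f: "?f \<in> borel_measurable (?X \<Otimes>\<^sub>M N)"
    by (intro measurable_pair_measure_countable1 countable_finite F) simp
  have "distr M (?X \<Otimes>\<^sub>M N) (\<lambda>\<omega>. (h (V \<omega>), V \<omega>)) = density (?X \<Otimes>\<^sub>M N) ?f"
  proof (rule measure_eqI)
    fix E assume "E \<in> sets (distr M (?X \<Otimes>\<^sub>M N) (\<lambda>\<omega>. (h (V \<omega>), V \<omega>)))"
    then have E[measurable]: "E \<in> sets (?X \<Otimes>\<^sub>M N)" by simp
    have "emeasure (density (?X \<Otimes>\<^sub>M N) ?f) E = (\<integral>\<^sup>+z. ?f z * indicator E z \<partial>(?X \<Otimes>\<^sub>M N))"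
      by (rule emeasure_density[OF f E])
    also have "\<dots> = (\<integral>\<^sup>+v. \<integral>\<^sup>+x. ?f (x, v) * indicator E (x, v) \<partial>?X \<partial>N)"
      using f by (intro nn_integral_snd[symmetric]) simp
    also have "\<dots> = (\<integral>\<^sup>+v. q v * indicator E (h v, v) \<partial>N)"
    proof (rule nn_integral_cong)
      fix v assume "v \<in> space N"
      then have "h v \<in> F" using measurable_space[OF h] by simp
      moreover have "(\<integral>\<^sup>+x. ?f (x, v) * indicator E (x, v) \<partial>?X)
          = (\<Sum>x\<in>F. if x = h v then q v * indicator E (h v, v) else 0)"
        using F by (subst nn_integral_count_space_finite) (auto intro!: sum.cong)
      ultimately show "(\<integral>\<^sup>+x. ?f (x, v) * indicator E (x, v) \<partial>?X) = q v * indicator E (h v, v)"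
        using F by simp
    qed
    also have "\<dots> = (\<integral>\<^sup>+\<omega>. indicator E (h (V \<omega>), V \<omega>) \<partial>M)"
      by (rule distributed_nn_integral[OF dist]) measurable
    also have "\<dots> = (\<integral>\<^sup>+z. indicator E z \<partial>distr M (?X \<Otimes>\<^sub>M N) (\<lambda>\<omega>. (h (V \<omega>), V \<omega>)))"
      by (subst nn_integral_distr) auto
    finally show "emeasure (distr M (?X \<Otimes>\<^sub>M N) (\<lambda>\<omega>. (h (V \<omega>), V \<omega>))) E = emeasure (density (?X \<Otimes>\<^sub>M N) ?f) E"
      using E by simp
  qed simp
  with f show ?thesis
    unfolding distributed_def by auto
qed

section \<open>The intersection property\<close>

text \<open>Every marginal keeps \<open>c\<close> fixed, so full support is asked of
  \<open>MA\<close> and \<open>MB\<close>, over which the marginals integrate. A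
  \<open>t1_space\<close> for \<open>c\<close> makes singletons closed, hence Borel, as a
  counterexample at a single \<open>c\<close> requires.\<close>

locale continuous_density =
  fixes MA :: "'a::topological_space measure"
    and MB :: "'b::topological_space measure"
    and MC :: "'c::t1_space measure"
    and p :: "'a \<times> 'b \<times> 'c \<Rightarrow> real"
  assumes sfA: "sigma_finite_measure MA" and sets_A: "sets MA = sets borel" and full_A: "full_support MA"
    and sfB: "sigma_finite_measure MB" and sets_B: "sets MB = sets borel" and full_B: "full_support MB"
    and sfC: "sigma_finite_measure MC" and sets_C: "sets MC = sets borel"
    and p_nonneg: "\<And>v. 0 \<le> p v"
    and p_meas: "(\<lambda>v. ennreal (p v)) \<in> borel_measurable (MA \<Otimes>\<^sub>M (MB \<Otimes>\<^sub>M MC))"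
    and finite_marg: "finite_marginals MA MB p"
    and p_cont: "continuous_on UNIV p"
begin

section \<open>Support and positivity of the marginals\<close>

lemma space_A: "space MA = UNIV" and space_B: "space MB = UNIV" and space_C: "space MC = UNIV"
  using sets_A sets_B sets_C by (auto dest: sets_eq_imp_space_eq)

lemmas spaces = space_A space_B space_C space_pair_measure

lemma continuous_on_p_comp:
  assumes "continuous_on UNIV g"
  shows "continuous_on UNIV (\<lambda>x. p (g x))"
  using continuous_on_compose2[OF p_cont assms] by simp

lemma open_supp_at: "open (supp_at p c)"
proof -
  have "open {s. 0 < p (fst s, snd s, c)}"
    by (intro open_Collect_less continuous_on_p_comp continuous_intros)
  then show ?thesis by (simp add: supp_at_def case_prod_unfold)
qed

text \<open>Continuity makes the slice \<open>{a. 0 < p (a, b, c)}\<close> open; as it is nonempty,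
  full support of \<open>MA\<close> turns positivity at one point into a positive integral.\<close>

lemma marginal_BC_pos:
  assumes "0 < p (a, b, c)"
  shows "0 < marginal_BC MA p b c"
  unfolding marginal_BC_def
proof (rule nn_integral_pos_if_pos_on_open[OF full_A])
  show "open {a. 0 < p (a, b, c)}"
    by (intro open_Collect_less continuous_on_p_comp continuous_intros)
  show "(\<lambda>a. ennreal (p (a, b, c))) \<in> borel_measurable MA"
    by (rule measurable_compose[OF _ p_meas]) (simp add: spaces)
qed (use assms in \<open>auto simp: spaces\<close>)

lemma marginal_AC_pos:
  assumes "0 < p (a, b, c)"
  shows "0 < marginal_AC MB p a c"
  unfolding marginal_AC_def
proof (rule nn_integral_pos_if_pos_on_open[OF full_B])
  show "open {b. 0 < p (a, b, c)}"
    by (intro open_Collect_less continuous_on_p_comp continuous_intros)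
  show "(\<lambda>b. ennreal (p (a, b, c))) \<in> borel_measurable MB"
    by (rule measurable_compose[OF _ p_meas]) (simp add: spaces)
qed (use assms in \<open>auto simp: spaces\<close>)

lemma marginal_C_pos_iff: "0 < marginal_C MA MB p c \<longleftrightarrow> supp_at p c \<noteq> {}"
proof
  assume "0 < marginal_C MA MB p c"
  then obtain s where "ennreal (p (fst s, snd s, c)) \<noteq> 0"
    unfolding marginal_C_def case_prod_unfold by fastforce
  then have "s \<in> supp_at p c"
    using p_nonneg[of "(fst s, snd s, c)"] by (auto simp: supp_at_def case_prod_unfold less_le)
  then show "supp_at p c \<noteq> {}" by blast
next
  assume "supp_at p c \<noteq> {}"
  then obtain a b where ab: "0 < p (a, b, c)" by (auto simp: supp_at_def)
  interpret B: sigma_finite_measure MB by (rule sfB)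
  have meas: "(\<lambda>(a, b). ennreal (p (a, b, c))) \<in> borel_measurable (MA \<Otimes>\<^sub>M MB)"
    unfolding case_prod_unfold by (rule measurable_compose[OF _ p_meas]) (simp add: spaces)
  \<comment> \<open>Full support is used one factor at a time, since an open subset of the product
    may lie outside the product sigma algebra: the inner integral is positive for every
    \<open>a\<close> in the open slice at \<open>b\<close>.\<close>
  have "0 < (\<integral>\<^sup>+a. marginal_AC MB p a c \<partial>MA)"
  proof (rule nn_integral_pos_if_pos_on_open[OF full_A])
    show "open {a. 0 < p (a, b, c)}"
      by (intro open_Collect_less continuous_on_p_comp continuous_intros)
    show "(\<lambda>a. marginal_AC MB p a c) \<in> borel_measurable MA"
      unfolding marginal_AC_def by (rule B.borel_measurable_nn_integral[OF meas])
  qed (use ab marginal_AC_pos in \<open>auto simp: spaces\<close>)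
  also have "\<dots> = marginal_C MA MB p c"
    using B.nn_integral_fst[OF meas] by (simp add: marginal_AC_def marginal_C_def)
  finally show "0 < marginal_C MA MB p c" .
qed

section \<open>The three conditional independences for a fixed extension of the density\<close>

context
  fixes MX :: "'x measure" and f :: "'x \<times> 'a \<times> 'b \<times> 'c \<Rightarrow> real"
  assumes sfX: "sigma_finite_measure MX"
    and f_meas: "(\<lambda>v. ennreal (f v)) \<in> borel_measurable (MX \<Otimes>\<^sub>M (MA \<Otimes>\<^sub>M (MB \<Otimes>\<^sub>M MC)))"
    and f_nonneg: "\<And>x v. x \<in> space MX \<Longrightarrow> 0 \<le> f (x, v)"
    and ext: "extends_density MX f p"
begin

lemma ext_integral: "(\<integral>\<^sup>+x. ennreal (f (x, v)) \<partial>MX) = ennreal (p v)"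
  and ext_zero: "x \<in> space MX \<Longrightarrow> p v = 0 \<Longrightarrow> f (x, v) = 0"
  using ext by (simp_all only: extends_density_def)

lemma ennreal_proportional_iff:
  "x \<in> space MX \<Longrightarrow> ennreal (f (x, u)) * ennreal (p v) = ennreal (f (x, v)) * ennreal (p u)
     \<longleftrightarrow> f (x, u) * p v = f (x, v) * p u"
  by (simp add: ennreal_mult[symmetric] f_nonneg p_nonneg)

text \<open>Integrating \<open>x\<close> out of \<open>f\<close> returns \<open>p\<close>, so the
  proportionality criterion applies with \<open>p\<close> as its \<open>q\<close>; its positivity
  condition is that of the marginal of \<open>(B,C)\<close>.\<close>

lemma cond_indep_A_iff:
  "cond_indep MX MA (MB \<Otimes>\<^sub>M MC) (\<lambda>(x, a, (b, c)). f (x, a, b, c)) \<longleftrightarrow>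
     (\<forall>x\<in>space MX. \<forall>a a' b c. f (x, a, b, c) * p (a', b, c) = f (x, a', b, c) * p (a, b, c))"
proof -
  have "cond_indep MX MA (MB \<Otimes>\<^sub>M MC) (\<lambda>(x, a, (b, c)). f (x, a, b, c)) \<longleftrightarrow>
      (\<forall>x\<in>space MX. \<forall>a\<in>space MA. \<forall>a'\<in>space MA. \<forall>z\<in>space (MB \<Otimes>\<^sub>M MC).
         ennreal (case (x, a, z) of (x, a, (b, c)) \<Rightarrow> f (x, a, b, c)) * ennreal (p (a', z))
       = ennreal (case (x, a', z) of (x, a, (b, c)) \<Rightarrow> f (x, a, b, c)) * ennreal (p (a, z)))"
  proof (rule cond_indep_iff_proportional[OF sfX sfA])
    fix z assume "z \<in> space (MB \<Otimes>\<^sub>M MC)"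
    then show "(\<lambda>(x, a). ennreal (case (x, a, z) of (x, a, (b, c)) \<Rightarrow> f (x, a, b, c)))
        \<in> borel_measurable (MX \<Otimes>\<^sub>M MA)"
      unfolding case_prod_unfold by (intro measurable_compose[OF _ f_meas]) simp
  next
    fix a z assume "0 < ennreal (p (a, z))"
    then show "0 < (\<integral>\<^sup>+a. ennreal (p (a, z)) \<partial>MA)"
      using marginal_BC_pos[of a "fst z" "snd z"] by (simp add: marginal_BC_def)
  next
    fix z
    show "(\<integral>\<^sup>+a. ennreal (p (a, z)) \<partial>MA) < \<infinity>"
      using finite_marg unfolding finite_marginals_def marginal_BC_def by (cases z) auto
  qed (auto simp: ext_integral ext_zero p_nonneg ennreal_eq_0_iff antisym split: prod.splits)
  then show ?thesis by (auto simp: ennreal_proportional_iff spaces)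
qed

lemma cond_indep_B_iff:
  "cond_indep MX MB (MA \<Otimes>\<^sub>M MC) (\<lambda>(x, b, (a, c)). f (x, a, b, c)) \<longleftrightarrow>
     (\<forall>x\<in>space MX. \<forall>a b b' c. f (x, a, b, c) * p (a, b', c) = f (x, a, b', c) * p (a, b, c))"
proof -
  have "cond_indep MX MB (MA \<Otimes>\<^sub>M MC) (\<lambda>(x, b, (a, c)). f (x, a, b, c)) \<longleftrightarrow>
      (\<forall>x\<in>space MX. \<forall>b\<in>space MB. \<forall>b'\<in>space MB. \<forall>z\<in>space (MA \<Otimes>\<^sub>M MC).
         ennreal (case (x, b, z) of (x, b, (a, c)) \<Rightarrow> f (x, a, b, c)) * ennreal (p (fst z, b', snd z))
       = ennreal (case (x, b', z) of (x, b, (a, c)) \<Rightarrow> f (x, a, b, c)) * ennreal (p (fst z, b, snd z)))"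
  proof (rule cond_indep_iff_proportional[OF sfX sfB])
    fix z assume "z \<in> space (MA \<Otimes>\<^sub>M MC)"
    then show "(\<lambda>(x, b). ennreal (case (x, b, z) of (x, b, (a, c)) \<Rightarrow> f (x, a, b, c)))
        \<in> borel_measurable (MX \<Otimes>\<^sub>M MB)"
      unfolding case_prod_unfold by (intro measurable_compose[OF _ f_meas]) (simp add: spaces)
  next
    fix b z assume "0 < ennreal (p (fst z, b, snd z))"
    then show "0 < (\<integral>\<^sup>+b. ennreal (p (fst z, b, snd z)) \<partial>MB)"
      using marginal_AC_pos[of "fst z" b "snd z"] by (simp add: marginal_AC_def)
  next
    fix z
    show "(\<integral>\<^sup>+b. ennreal (p (fst z, b, snd z)) \<partial>MB) < \<infinity>"
      using finite_marg unfolding finite_marginals_def marginal_AC_def by auto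
  qed (auto simp: ext_integral ext_zero p_nonneg ennreal_eq_0_iff antisym split: prod.splits)
  then show ?thesis by (auto simp: ennreal_proportional_iff spaces)
qed

text \<open>The pair \<open>(a, b)\<close> acts as one variable, dominated by the sigma-finite
  product of \<open>MA\<close> and \<open>MB\<close>.\<close>

lemma cond_indep_AB_iff:
  "cond_indep MX (MA \<Otimes>\<^sub>M MB) MC (\<lambda>(x, (a, b), c). f (x, a, b, c)) \<longleftrightarrow>
     (\<forall>x\<in>space MX. \<forall>a b a' b' c. f (x, a, b, c) * p (a', b', c) = f (x, a', b', c) * p (a, b, c))"
proof -
  have "cond_indep MX (MA \<Otimes>\<^sub>M MB) MC (\<lambda>(x, (a, b), c). f (x, a, b, c)) \<longleftrightarrow>
      (\<forall>x\<in>space MX. \<forall>s\<in>space (MA \<Otimes>\<^sub>M MB). \<forall>s'\<in>space (MA \<Otimes>\<^sub>M MB). \<forall>c\<in>space MC.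
         ennreal ((\<lambda>(x, (a, b), c). f (x, a, b, c)) (x, s, c)) * ennreal (p (fst s', snd s', c))
       = ennreal ((\<lambda>(x, (a, b), c). f (x, a, b, c)) (x, s', c)) * ennreal (p (fst s, snd s, c)))"
  proof (rule cond_indep_iff_proportional[OF sfX, where q = "\<lambda>s c. ennreal (p (fst s, snd s, c))"])
    show "sigma_finite_measure (MA \<Otimes>\<^sub>M MB)" by (rule sigma_finite_pair_measure[OF sfA sfB])
  next
    fix c assume "c \<in> space MC"
    then show "(\<lambda>(x, s). ennreal ((\<lambda>(x, (a, b), c). f (x, a, b, c)) (x, s, c)))
        \<in> borel_measurable (MX \<Otimes>\<^sub>M (MA \<Otimes>\<^sub>M MB))"
      unfolding case_prod_unfold by (intro measurable_compose[OF _ f_meas]) simp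
  next
    fix s c assume "0 < ennreal (p (fst s, snd s, c))"
    then have "s \<in> supp_at p c" by (simp add: supp_at_def case_prod_unfold)
    then show "0 < (\<integral>\<^sup>+s. ennreal (p (fst s, snd s, c)) \<partial>(MA \<Otimes>\<^sub>M MB))"
      using marginal_C_pos_iff[of c] by (auto simp: marginal_C_def case_prod_unfold)
  next
    fix c
    show "(\<integral>\<^sup>+s. ennreal (p (fst s, snd s, c)) \<partial>(MA \<Otimes>\<^sub>M MB)) < \<infinity>"
      using finite_marg unfolding finite_marginals_def marginal_C_def case_prod_unfold by auto
  qed (auto simp: ext_integral ext_zero p_nonneg ennreal_eq_0_iff antisym split: prod.splits)
  then show ?thesis by (auto simp: ennreal_proportional_iff spaces)
qed

lemma cond_indep_AB_if_single_class:
  assumes single: "\<And>c s. s \<in> supp_at p c \<Longrightarrow> supp_at p c \<subseteq> coord_class (supp_at p c) s"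
    and A: "cond_indep MX MA (MB \<Otimes>\<^sub>M MC) (\<lambda>(x, a, (b, c)). f (x, a, b, c))"
    and B: "cond_indep MX MB (MA \<Otimes>\<^sub>M MC) (\<lambda>(x, b, (a, c)). f (x, a, b, c))"
  shows "cond_indep MX (MA \<Otimes>\<^sub>M MB) MC (\<lambda>(x, (a, b), c). f (x, a, b, c))"
  unfolding cond_indep_AB_iff
proof (intro ballI allI)
  fix x a b a' b' c assume x: "x \<in> space MX"
  \<comment> \<open>\<open>?r\<close> is the conditional density of \<open>X\<close> at
    \<open>x\<close> given \<open>(s, c)\<close>; each link of a chain preserves it.\<close>
  let ?S = "supp_at p c" and ?r = "\<lambda>s. f (x, fst s, snd s, c) / p (fst s, snd s, c)"
  have supp: "s \<in> ?S \<longleftrightarrow> 0 < p (fst s, snd s, c)" for s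
    by (simp add: supp_at_def case_prod_unfold)
  show "f (x, a, b, c) * p (a', b', c) = f (x, a', b', c) * p (a, b, c)"
  proof (cases "(a, b) \<in> ?S \<and> (a', b') \<in> ?S")
    case True
    then have "((a, b), (a', b')) \<in> (coord_step ?S)\<^sup>*"
      using single[of "(a, b)" c] by (auto simp: coord_class_def)
    then have "?r (a, b) = ?r (a', b')"
    proof induction
      case (step s t)
      then have "0 < p (fst s, snd s, c)" "0 < p (fst t, snd t, c)" "fst s = fst t \<or> snd s = snd t"
        by (auto simp: coord_step_def supp)
      \<comment> \<open>Independence from \<open>A\<close> handles a link with common second
        coordinate, independence from \<open>B\<close> one with common first coordinate.\<close>
      moreover from this have "f (x, fst s, snd s, c) * p (fst t, snd t, c) = f (x, fst t, snd t, c) * p (fst s, snd s, c)"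
        using A[unfolded cond_indep_A_iff] B[unfolded cond_indep_B_iff] x by metis
      ultimately have "?r s = ?r t" by (simp add: frac_eq_eq)
      with step.IH show ?case by simp
    qed simp
    with True show ?thesis by (simp add: supp frac_eq_eq)
  next
    case False
    \<comment> \<open>Wherever \<open>p\<close> is 0, \<open>f\<close> is 0 for every
      \<open>x\<close>; one such point makes both products vanish.\<close>
    then have "p (a, b, c) = 0 \<or> p (a', b', c) = 0"
      using p_nonneg by (auto simp: supp not_less intro: antisym)
    then show ?thesis using ext_zero[OF x] by auto
  qed
qed

end

lemma intersection_property_if_single_class:
  assumes "\<And>c s. s \<in> supp_at p c \<Longrightarrow> supp_at p c \<subseteq> coord_class (supp_at p c) s"
  shows "intersection_property TYPE('x) M MA MB MC A B C p"
  unfolding intersection_property_def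
proof (intro allI impI)
  fix MX :: "'x measure" and X f
  assume "sigma_finite_measure MX" "extends_density MX f p"
    and dens: "has_density M (MX \<Otimes>\<^sub>M (MA \<Otimes>\<^sub>M (MB \<Otimes>\<^sub>M MC))) (\<lambda>\<omega>. (X \<omega>, A \<omega>, B \<omega>, C \<omega>)) f"
    and "cond_indep MX MA (MB \<Otimes>\<^sub>M MC) (\<lambda>(x, a, (b, c)). f (x, a, b, c))"
    and "cond_indep MX MB (MA \<Otimes>\<^sub>M MC) (\<lambda>(x, b, (a, c)). f (x, a, b, c))"
  moreover have "(\<lambda>v. ennreal (f v)) \<in> borel_measurable (MX \<Otimes>\<^sub>M (MA \<Otimes>\<^sub>M (MB \<Otimes>\<^sub>M MC)))"
    using dens by (simp add: has_density_def distributed_def)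
  moreover have "0 \<le> f (x, v)" if "x \<in> space MX" for x v
    using dens that by (cases v) (auto simp: has_density_def spaces)
  ultimately show "cond_indep MX (MA \<Otimes>\<^sub>M MB) MC (\<lambda>(x, (a, b), c). f (x, a, b, c))"
    using assms by (intro cond_indep_AB_if_single_class)
qed

section \<open>Necessity of a single class\<close>

text \<open>If a class \<open>U\<close> at \<open>c\<^sub>0\<close> misses a point of the support, then the indicator of \<open>(A,B) \<in> U\<close>,
  \<open>C = c\<^sub>0\<close> violates the intersection property. On the support it is a function of \<open>(A,C)\<close> as
  well as of \<open>(B,C)\<close>; writing it through \<open>fst ` U\<close> makes it measurable although \<open>U\<close> itself may lie
  outside the product sigma algebra.\<close>
lemma single_class_if_intersection_property:
  fixes A :: "'w \<Rightarrow> 'a"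
  assumes dens: "has_density M (MA \<Otimes>\<^sub>M (MB \<Otimes>\<^sub>M MC)) (\<lambda>\<omega>. (A \<omega>, B \<omega>, C \<omega>)) p"
    and "\<exists>x y :: 'x. x \<noteq> y"
    and inter: "intersection_property TYPE('x) M MA MB MC A B C p"
    and s: "s \<in> supp_at p c\<^sub>0"
  shows "supp_at p c\<^sub>0 \<subseteq> coord_class (supp_at p c\<^sub>0) s"
proof
  fix t assume t: "t \<in> supp_at p c\<^sub>0"
  obtain x\<^sub>0 x\<^sub>1 :: 'x where x01: "x\<^sub>0 \<noteq> x\<^sub>1" using assms(2) by blast
  define U where "U = coord_class (supp_at p c\<^sub>0) s"
  \<comment> \<open>Support points sharing a coordinate lie in the same class. Hence membership in
    \<open>U\<close> can be read off from \<open>a\<close> alone, and by the next fact it survives a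
    change of \<open>a\<close> at fixed \<open>b\<close>.\<close>
  have U_fst: "a \<in> fst ` U \<longleftrightarrow> (a, b) \<in> U" if "(a, b) \<in> supp_at p c\<^sub>0" for a b
    using that coord_class_closed[of _ "supp_at p c\<^sub>0" s "(a, b)"] coord_class_subset[OF s]
    unfolding U_def by force
  have U_snd: "(a, b) \<in> U \<longleftrightarrow> (a', b) \<in> U"
    if "(a, b) \<in> supp_at p c\<^sub>0" "(a', b) \<in> supp_at p c\<^sub>0" for a a' b
    using that coord_class_closed[of "(a, b)" "supp_at p c\<^sub>0" s "(a', b)"]
      coord_class_closed[of "(a', b)" "supp_at p c\<^sub>0" s "(a, b)"]
    unfolding U_def by auto
  \<comment> \<open>Away from \<open>c\<^sub>0\<close> the default \<open>x\<^sub>0\<close> keeps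
    \<open>h\<close> constant. If \<open>C = c\<^sub>0\<close> has probability zero,
    \<open>h\<close> is almost surely constant and the violation shows only in the pointwise
    density.\<close>
  define h where "h = (\<lambda>(a, b::'b, c). if c = c\<^sub>0 \<and> a \<in> fst ` U then x\<^sub>1 else x\<^sub>0)"
  define f where "f = (\<lambda>(x, v). if x = h v then p v else 0)"
  let ?N = "MA \<Otimes>\<^sub>M (MB \<Otimes>\<^sub>M MC)" and ?X = "count_space {x\<^sub>0, x\<^sub>1}"
  \<comment> \<open>\<open>U\<close> is open and projections are open maps.\<close>
  have "fst ` U \<in> sets MA"
    using open_image_fst[OF open_coord_class[OF open_supp_at s]] by (simp add: sets_A U_def)
  moreover have "{c\<^sub>0} \<in> sets MC" by (simp add: sets_C)
  ultimately have "Measurable.pred ?N (\<lambda>v. snd (snd v) = c\<^sub>0 \<and> fst v \<in> fst ` U)"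
    by measurable
  then have h: "h \<in> measurable ?N ?X"
    unfolding h_def case_prod_unfold by (intro measurable_If) auto
  have sfX: "sigma_finite_measure ?X"
    by (simp add: sigma_finite_measure_count_space_finite)
  have "sigma_finite_measure ?N"
    by (intro sigma_finite_pair_measure sfA sfB sfC)
  then have "distributed M (?X \<Otimes>\<^sub>M ?N) (\<lambda>\<omega>. (h (A \<omega>, B \<omega>, C \<omega>), A \<omega>, B \<omega>, C \<omega>))
      (\<lambda>(x, v). if x = h v then ennreal (p v) else 0)"
    using dens h by (intro distributed_graph) (auto simp: has_density_def)
  moreover have "(\<lambda>(x, v). if x = h v then ennreal (p v) else 0) = (\<lambda>z. ennreal (f z))"
    by (auto simp: f_def fun_eq_iff)
  ultimately have f_dens: "has_density M (?X \<Otimes>\<^sub>M ?N) (\<lambda>\<omega>. (h (A \<omega>, B \<omega>, C \<omega>), A \<omega>, B \<omega>, C \<omega>)) f"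
    by (auto simp: has_density_def f_def p_nonneg)
  have h_in: "h v \<in> {x\<^sub>0, x\<^sub>1}" for v
    by (simp add: h_def case_prod_unfold)
  have ext: "extends_density ?X f p"
    unfolding extends_density_def
  proof (intro conjI allI ballI impI)
    fix v
    have "(\<integral>\<^sup>+x. ennreal (f (x, v)) \<partial>?X) = (\<Sum>x\<in>{x\<^sub>0, x\<^sub>1}. ennreal (f (x, v)))"
      by (simp add: nn_integral_count_space_finite)
    then show "(\<integral>\<^sup>+x. ennreal (f (x, v)) \<partial>?X) = ennreal (p v)"
      using h_in[of v] x01 by (auto simp: f_def)
  qed (simp add: f_def)
  have f_meas: "(\<lambda>v. ennreal (f v)) \<in> borel_measurable (?X \<Otimes>\<^sub>M ?N)"
    using f_dens by (simp add: has_density_def distributed_def)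
  have f_nonneg: "0 \<le> f (x, v)" for x v
    by (simp add: f_def p_nonneg)
  note cond_indep_iffs = cond_indep_A_iff[OF sfX f_meas f_nonneg ext]
    cond_indep_B_iff[OF sfX f_meas f_nonneg ext] cond_indep_AB_iff[OF sfX f_meas f_nonneg ext]
  \<comment> \<open>If \<open>p\<close> is 0 at either point, both sides vanish; otherwise
    \<open>h u = h v\<close> makes both sides \<open>p u * p v\<close> or both 0.\<close>
  have proportional: "f (x, u) * p v = f (x, v) * p u" if "0 < p u \<Longrightarrow> 0 < p v \<Longrightarrow> h u = h v" for x u v
    using that p_nonneg[of u] p_nonneg[of v] by (cases "p u = 0"; cases "p v = 0") (auto simp: f_def)
  have supp: "0 < p (a, b, c\<^sub>0) \<longleftrightarrow> (a, b) \<in> supp_at p c\<^sub>0" for a b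
    by (simp add: supp_at_def)
  \<comment> \<open>\<open>U_fst\<close> trades the projection for membership in \<open>U\<close>,
    which \<open>U_snd\<close> carries from \<open>a\<close> to \<open>a'\<close>.\<close>
  have "h (a, b, c) = h (a', b, c)" if "0 < p (a, b, c)" "0 < p (a', b, c)" for a a' b c
  proof -
    have "a \<in> fst ` U \<longleftrightarrow> a' \<in> fst ` U" if "c = c\<^sub>0"
      using \<open>0 < p (a, b, c)\<close> \<open>0 < p (a', b, c)\<close> that U_fst U_snd supp by metis
    then show ?thesis by (simp add: h_def cong: conj_cong)
  qed
  then have indep_A: "cond_indep ?X MA (MB \<Otimes>\<^sub>M MC) (\<lambda>(x, a, (b, c)). f (x, a, b, c))"
    unfolding cond_indep_iffs by (intro ballI allI proportional)
  \<comment> \<open>\<open>h\<close> depends on \<open>a\<close> and \<open>c\<close> only, so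
    moving \<open>b\<close> leaves it unchanged.\<close>
  have indep_B: "cond_indep ?X MB (MA \<Otimes>\<^sub>M MC) (\<lambda>(x, b, (a, c)). f (x, a, b, c))"
    unfolding cond_indep_iffs by (intro ballI allI proportional) (simp add: h_def)
  have "cond_indep ?X (MA \<Otimes>\<^sub>M MB) MC (\<lambda>(x, (a, b), c). f (x, a, b, c))"
    using inter[unfolded intersection_property_def, rule_format, OF sfX f_dens ext indep_A indep_B] .
  \<comment> \<open>At \<open>x\<^sub>1\<close> the left side is positive, because \<open>h\<close>
    takes that value at \<open>s\<close>; so \<open>f\<close> cannot vanish at
    \<open>t\<close>.\<close>
  then have "f (x\<^sub>1, fst s, snd s, c\<^sub>0) * p (fst t, snd t, c\<^sub>0) = f (x\<^sub>1, fst t, snd t, c\<^sub>0) * p (fst s, snd s, c\<^sub>0)"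
    unfolding cond_indep_iffs by simp
  moreover have "h (fst s, snd s, c\<^sub>0) = x\<^sub>1"
    using coord_class_self[of s] by (auto simp: h_def U_def)
  ultimately have "h (fst t, snd t, c\<^sub>0) = x\<^sub>1"
    using s t supp[of "fst s" "snd s"] supp[of "fst t" "snd t"] by (auto simp: f_def split: if_splits)
  then show "t \<in> coord_class (supp_at p c\<^sub>0) s"
    using x01 U_fst[of "fst t" "snd t"] t by (auto simp: h_def U_def split: if_splits)
qed

end

text \<open>The conditions on the components do not mention \<open>'x\<close>. Two distinct values
  suffice for the counterexample, so the property for binary \<open>X\<close> already yields it for
  every type with two elements.\<close>

theorem corollary1:
  fixes M :: "'w measure"
    and MA :: "'a::metric_space measure"
    and MB :: "'b::metric_space measure"
    and MC :: "'c::metric_space measure"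
    and A :: "'w \<Rightarrow> 'a" and B :: "'w \<Rightarrow> 'b" and C :: "'w \<Rightarrow> 'c"
    and p :: "'a \<times> 'b \<times> 'c \<Rightarrow> real"
  assumes "prob_space M"
    and "sigma_finite_measure MA" and "sets MA = sets borel" and "full_support MA"
    and "sigma_finite_measure MB" and "sets MB = sets borel" and "full_support MB"
    and "sigma_finite_measure MC" and "sets MC = sets borel"
    and "has_density M (MA \<Otimes>\<^sub>M (MB \<Otimes>\<^sub>M MC)) (\<lambda>\<omega>. (A \<omega>, B \<omega>, C \<omega>)) p"
    and "finite_marginals MA MB p"
    and "continuous_on UNIV p"
    and "\<exists>x y :: 'x. x \<noteq> y"
  shows "(intersection_property TYPE('x) M MA MB MC A B C p \<longleftrightarrow>
            (\<forall>c. marginal_C MA MB p c > 0 \<longrightarrow> all_comps_equivalent (supp_at p c))) \<and>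
         ((\<forall>c. marginal_C MA MB p c > 0 \<longrightarrow> all_comps_equivalent (supp_at p c)) \<longleftrightarrow>
            (\<forall>c. marginal_C MA MB p c > 0 \<longrightarrow> (\<exists>!U. U \<in> component_unions (supp_at p c)))) \<and>
         ((\<forall>c. marginal_C MA MB p c > 0 \<longrightarrow> (\<exists>!Z. Z \<in> path_comps (supp_at p c))) \<longrightarrow>
            intersection_property TYPE('x) M MA MB MC A B C p) \<and>
         ((\<forall>a b c. p (a, b, c) > 0) \<longrightarrow>
            intersection_property TYPE('x) M MA MB MC A B C p)"
proof -
  have dens: "has_density M (MA \<Otimes>\<^sub>M (MB \<Otimes>\<^sub>M MC)) (\<lambda>\<omega>. (A \<omega>, B \<omega>, C \<omega>)) p"
    by fact
  have "space MA = UNIV" "space MB = UNIV" "space MC = UNIV"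
    using assms(3,6,9) by (simp_all add: sets_eq_imp_space_eq)
  then have "0 \<le> p v" for v
    using dens by (cases v) (simp add: has_density_def space_pair_measure)
  then interpret continuous_density MA MB MC p
    using dens assms by (simp add: continuous_density_def has_density_def distributed_def)
  note equiv_iff = all_comps_equivalent_iff_coord_class[OF open_supp_at]
  let ?I = "intersection_property TYPE('x) M MA MB MC A B C p"
  have "?I \<longleftrightarrow> (\<forall>c. \<forall>s\<in>supp_at p c. supp_at p c \<subseteq> coord_class (supp_at p c) s)"
    using single_class_if_intersection_property[OF dens \<open>\<exists>x y :: 'x. x \<noteq> y\<close>]
      intersection_property_if_single_class by blast
  \<comment> \<open>Where the marginal at \<open>c\<close> vanishes, the support at \<open>c\<close>
    is empty and the class condition is vacuous.\<close>
  then have I: "?I \<longleftrightarrow> (\<forall>c. marginal_C MA MB p c > 0 \<longrightarrow> all_comps_equivalent (supp_at p c))"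
    unfolding equiv_iff marginal_C_pos_iff by blast
  have equiv_if_connected: "all_comps_equivalent (supp_at p c)" if "\<exists>!Z. Z \<in> path_comps (supp_at p c)" for c
    using that unfolding all_comps_equivalent_def equivalent_comps_def by blast
  have equiv_if_positive: "all_comps_equivalent (supp_at p c)" if "\<forall>a b c. p (a, b, c) > 0" for c
  proof -
    have supp_UNIV: "supp_at p c = UNIV" using that by (auto simp: supp_at_def)
    \<comment> \<open>In the full product the corner \<open>(a, b')\<close> links
      \<open>(a, b)\<close> to \<open>(a', b')\<close>.\<close>
    have "(a', b') \<in> coord_class UNIV (a, b)" for a a' :: 'a and b b' :: 'b
      using coord_class_closed[of "(a, b')" UNIV "(a, b)" "(a', b')"]
        coord_class_closed[OF coord_class_self, of "(a, b)" UNIV "(a, b')"] by simp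
    then show ?thesis using equiv_iff[of c] by (auto simp: supp_UNIV)
  qed
  have "(\<exists>!U. U \<in> component_unions (supp_at p c)) \<longleftrightarrow> all_comps_equivalent (supp_at p c)"
    if "marginal_C MA MB p c > 0" for c
    using that ex1_component_union_iff by (simp only: marginal_C_pos_iff)
  then show ?thesis
    using I equiv_if_connected equiv_if_positive by (intro conjI) (simp_all only: simp_thms cong: imp_cong)
qed

end
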